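(* The essential image of the nerve functor $N:\mathsf{Mag}\to\mathsf{Set}_\Delta$, $N(M)_n=\mathrm{Hom}_{\mathsf{Mag}}(\mathfrak D^n,M)$, from partial unital magmas to simplicial sets, consists of precisely the spiny, reduced, 2-coskeletal simplicial sets.
   Context: A partial unital magma $(M,\cdot,1)$ is a set $M$ with a partially defined binary operation $\cdot$ (pairs in its domain are called multiplicable) and an element $1\in M$ such that for every $m\in M$ the pairs $(m,1),(1,m)$ are multiplicable and $m\cdot 1=m=1\cdot m$. Morphisms in $\mathsf{Mag}$ are maps of sets $f$ with $f(1)=1$ such that if $(m,n)$ is multiplicable then so is $(f(m),f(n))$ and $f(m\cdot n)=f(m)\cdot f(n)$. $\mathfrak D^n$ is the partial unital magma with non-identity elements $m_{i,j}$, $0\le i<j\le n$, and identity $1$, where the multiplicable pairs of non-identity elements are $(m_{i,j},m_{j,k})$ with $i<j<k$, and $m_{i,j}\cdot m_{j,k}=m_{i,k}$. A monotone map $\phi:[n]\to[k]$ induces $m_{i,j}\mapsto m_{\phi(i),\phi(j)}$ with $m_{i,i}=1$, making $\mathfrak D^\bullet$ a cosimplicial object. A simplicial set $X$ is reduced if $X_0$ is a singleton. It is spiny if for all $n\ge2$ the map $X_n\to X_1\times_{X_0}\cdots\times_{X_0}X_1$ given by restriction to the spine of $\Delta^n$ (the edges $\{i,i+1\}$) is injective. It is 2-coskeletal if it is in the essential image of the right adjoint of the 2-truncation functor; equivalently, for every $n>2$ every map $\partial\Delta^n\to X$ extends uniquely to $\Delta^n$. *)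

theory Defs
  imports Main "HOL-Library.FuncSet"
begin

section \<open>The simplex category\<close>

text \<open>\<open>[n]\<close> is \<open>{..n}\<close>.  Morphisms are extensional functions, so that two morphisms are equal
  as HOL functions iff they agree on \<open>{..m}\<close>.\<close>

definition simplex_hom :: "nat \<Rightarrow> nat \<Rightarrow> (nat \<Rightarrow> nat) set" where
  "simplex_hom m n = {\<phi> \<in> {..m} \<rightarrow>\<^sub>E {..n}. mono_on {..m} \<phi>}"

definition simplex_id :: "nat \<Rightarrow> nat \<Rightarrow> nat" where
  "simplex_id n = (\<lambda>i\<in>{..n}. i)"


section \<open>Simplicial sets\<close>

text \<open>For \<open>\<phi> : [m] \<rightarrow> [n]\<close>, the induced map \<open>X\<^sub>n \<rightarrow> X\<^sub>m\<close> is \<open>act X m n \<phi>\<close>.\<close>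

record 'a sset =
  simplices :: "nat \<Rightarrow> 'a set"
  act :: "nat \<Rightarrow> nat \<Rightarrow> (nat \<Rightarrow> nat) \<Rightarrow> 'a \<Rightarrow> 'a"

locale simplicial_set =
  fixes X :: "'a sset"
  assumes act_closed:
      "\<phi> \<in> simplex_hom m n \<Longrightarrow> x \<in> simplices X n \<Longrightarrow> act X m n \<phi> x \<in> simplices X m"
    and act_id:
      "x \<in> simplices X n \<Longrightarrow> act X n n (simplex_id n) x = x"
    and act_comp:
      "\<phi> \<in> simplex_hom k m \<Longrightarrow> \<psi> \<in> simplex_hom m n \<Longrightarrow> x \<in> simplices X n \<Longrightarrow>
         act X k n (compose {..k} \<psi> \<phi>) x = act X k m \<phi> (act X m n \<psi> x)"

text \<open>The components are extensional, so that uniqueness of simplicial maps can be expressed by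
  equality of HOL functions.\<close>

definition simplicial_map :: "'a sset \<Rightarrow> 'b sset \<Rightarrow> (nat \<Rightarrow> 'a \<Rightarrow> 'b) \<Rightarrow> bool" where
  "simplicial_map X Y F \<longleftrightarrow>
     (\<forall>n. F n \<in> simplices X n \<rightarrow>\<^sub>E simplices Y n) \<and>
     (\<forall>m n. \<forall>\<phi>\<in>simplex_hom m n. \<forall>x\<in>simplices X n.
        F m (act X m n \<phi> x) = act Y m n \<phi> (F n x))"

definition sset_iso :: "'a sset \<Rightarrow> 'b sset \<Rightarrow> bool" where
  "sset_iso X Y \<longleftrightarrow>
     (\<exists>F G. simplicial_map X Y F \<and> simplicial_map Y X G \<and>
        (\<forall>n. \<forall>x\<in>simplices X n. G n (F n x) = x) \<and>
        (\<forall>n. \<forall>y\<in>simplices Y n. F n (G n y) = y))"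

definition reduced :: "'a sset \<Rightarrow> bool" where
  "reduced X \<longleftrightarrow> is_singleton (simplices X 0)"

text \<open>The inclusion \<open>[1] \<rightarrow> [n]\<close> with image \<open>{i, i + 1}\<close>.\<close>

definition spine_edge :: "nat \<Rightarrow> nat \<Rightarrow> nat" where
  "spine_edge i = (\<lambda>j\<in>{..1}. i + j)"

text \<open>An \<open>n\<close>-tuple of edges is a function on \<open>{..<n}\<close>.  The iterated fibre product over \<open>X\<^sub>0\<close>
  consists of the tuples in which the target of each edge is the source of the next.\<close>

definition spine_product :: "'a sset \<Rightarrow> nat \<Rightarrow> (nat \<Rightarrow> 'a) set" where
  "spine_product X n =
     {e \<in> {..<n} \<rightarrow>\<^sub>E simplices X 1.
        \<forall>i. Suc i < n \<longrightarrow> act X 0 1 (\<lambda>_\<in>{..0}. 1) (e i) = act X 0 1 (\<lambda>_\<in>{..0}. 0) (e (Suc i))}"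

definition spine_map :: "'a sset \<Rightarrow> nat \<Rightarrow> 'a \<Rightarrow> (nat \<Rightarrow> 'a)" where
  "spine_map X n x = (\<lambda>i\<in>{..<n}. act X 1 n (spine_edge i) x)"

definition spiny :: "'a sset \<Rightarrow> bool" where
  "spiny X \<longleftrightarrow>
     (\<forall>n\<ge>2. inj_on (spine_map X n) (simplices X n))"

definition standard_simplex :: "nat \<Rightarrow> (nat \<Rightarrow> nat) sset" where
  "standard_simplex n =
     \<lparr>simplices = (\<lambda>k. simplex_hom k n), act = (\<lambda>l k \<phi> \<sigma>. compose {..l} \<sigma> \<phi>)\<rparr>"

definition boundary_simplex :: "nat \<Rightarrow> (nat \<Rightarrow> nat) sset" where
  "boundary_simplex n =
     \<lparr>simplices = (\<lambda>k. {\<sigma> \<in> simplex_hom k n. \<sigma> ` {..k} \<noteq> {..n}}),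
      act = (\<lambda>l k \<phi> \<sigma>. compose {..l} \<sigma> \<phi>)\<rparr>"

definition two_coskeletal :: "'a sset \<Rightarrow> bool" where
  "two_coskeletal X \<longleftrightarrow>
     (\<forall>n>2. \<forall>F. simplicial_map (boundary_simplex n) X F \<longrightarrow>
        (\<exists>!G. simplicial_map (standard_simplex n) X G \<and>
              (\<forall>k. \<forall>\<sigma>\<in>simplices (boundary_simplex n) k. G k \<sigma> = F k \<sigma>)))"


section \<open>Partial unital magmas\<close>

text \<open>\<open>pmult M x y = None\<close> means that \<open>(x, y)\<close> is not multiplicable; the values of \<open>pmult\<close>
  outside \<open>elems M\<close> are irrelevant.\<close>

record 'a pmag =
  elems :: "'a set"
  pmult :: "'a \<Rightarrow> 'a \<Rightarrow> 'a option"
  pone :: 'a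

locale partial_unital_magma =
  fixes M :: "'a pmag"
  assumes pone_closed: "pone M \<in> elems M"
    and pmult_closed:
      "x \<in> elems M \<Longrightarrow> y \<in> elems M \<Longrightarrow> pmult M x y = Some z \<Longrightarrow> z \<in> elems M"
    and pmult_pone: "x \<in> elems M \<Longrightarrow> pmult M x (pone M) = Some x"
    and pone_pmult: "x \<in> elems M \<Longrightarrow> pmult M (pone M) x = Some x"

definition mag_hom :: "'a pmag \<Rightarrow> 'b pmag \<Rightarrow> ('a \<Rightarrow> 'b) set" where
  "mag_hom M N =
     {f \<in> elems M \<rightarrow>\<^sub>E elems N.
        f (pone M) = pone N \<and>
        (\<forall>x\<in>elems M. \<forall>y\<in>elems M. \<forall>z.
           pmult M x y = Some z \<longrightarrow> pmult N (f x) (f y) = Some (f z))}"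


section \<open>The cosimplicial object and the nerve\<close>

datatype dgen = DOne | DGen nat nat

fun dgen_mult :: "dgen \<Rightarrow> dgen \<Rightarrow> dgen option" where
  "dgen_mult DOne y = Some y"
| "dgen_mult x DOne = Some x"
| "dgen_mult (DGen i j) (DGen k l) = (if j = k then Some (DGen i l) else None)"

definition D_mag :: "nat \<Rightarrow> dgen pmag" where
  "D_mag n = \<lparr>elems = insert DOne {DGen i j |i j. i < j \<and> j \<le> n}, pmult = dgen_mult, pone = DOne\<rparr>"

fun D_map :: "(nat \<Rightarrow> nat) \<Rightarrow> dgen \<Rightarrow> dgen" where
  "D_map \<phi> DOne = DOne"
| "D_map \<phi> (DGen i j) = (if \<phi> i = \<phi> j then DOne else DGen (\<phi> i) (\<phi> j))"

definition nerve :: "'a pmag \<Rightarrow> (dgen \<Rightarrow> 'a) sset" where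
  "nerve M =
     \<lparr>simplices = (\<lambda>n. mag_hom (D_mag n) M),
      act = (\<lambda>m n \<phi> f. compose (elems (D_mag m)) f (D_map \<phi>))\<rparr>"

definition nerve_map :: "'a pmag \<Rightarrow> ('a \<Rightarrow> 'b) \<Rightarrow> nat \<Rightarrow> (dgen \<Rightarrow> 'a) \<Rightarrow> (dgen \<Rightarrow> 'b)" where
  "nerve_map M h n = (\<lambda>f\<in>mag_hom (D_mag n) M. compose (elems (D_mag n)) h f)"


section \<open>Well-definedness\<close>

lemma simplex_id_hom: "simplex_id n \<in> simplex_hom n n"
  by (auto simp: simplex_id_def simplex_hom_def mono_on_def)

lemma simplex_comp_hom:
  "\<phi> \<in> simplex_hom k m \<Longrightarrow> \<psi> \<in> simplex_hom m n \<Longrightarrow> compose {..k} \<psi> \<phi> \<in> simplex_hom k n"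
  unfolding simplex_hom_def compose_def
  by (simp add: mono_on_def PiE_iff)

lemma simplex_comp_id: "\<sigma> \<in> simplex_hom k n \<Longrightarrow> compose {..k} \<sigma> (simplex_id k) = \<sigma>"
  by (rule extensionalityI[of _ "{..k}"])
    (auto simp: simplex_hom_def simplex_id_def compose_def PiE_iff)

lemma simplex_comp_assoc:
  "\<phi> \<in> simplex_hom k m \<Longrightarrow> compose {..k} (compose {..m} \<sigma> \<psi>) \<phi> = compose {..k} \<sigma> (compose {..k} \<psi> \<phi>)"
  by (rule extensionalityI[of _ "{..k}"])
    (auto simp: simplex_hom_def compose_def PiE_iff)

lemma spine_edge_hom: "i < n \<Longrightarrow> spine_edge i \<in> simplex_hom 1 n"
  by (auto simp: spine_edge_def simplex_hom_def mono_on_def)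

lemma spine_map_spine_product:
  assumes "simplicial_set X" "x \<in> simplices X n"
  shows "spine_map X n x \<in> spine_product X n"
proof -
  interpret simplicial_set X by fact
  have v: "(\<lambda>_\<in>{..0}. c) \<in> simplex_hom 0 1" if "c \<le> 1" for c :: nat
    using that by (auto simp: simplex_hom_def mono_on_def)
  have "act X 0 1 (\<lambda>_\<in>{..0}. 1) (act X 1 n (spine_edge i) x)
      = act X 0 1 (\<lambda>_\<in>{..0}. 0) (act X 1 n (spine_edge (Suc i)) x)" if "Suc i < n" for i
  proof -
    have "compose {..0} (spine_edge i) (\<lambda>_\<in>{..0}. 1)
        = compose {..0} (spine_edge (Suc i)) (\<lambda>_\<in>{..0}. 0)"
      by (auto simp: compose_def spine_edge_def)
    then show ?thesis
      using act_comp[OF v spine_edge_hom assms(2)] that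
      by (metis Suc_lessD le_numeral_extra(4) zero_le)
  qed
  then show ?thesis
    using assms(2) act_closed[OF spine_edge_hom]
    by (auto simp: spine_product_def spine_map_def)
qed

lemma simplicial_set_standard_simplex: "simplicial_set (standard_simplex n)"
  by unfold_locales
    (simp_all add: standard_simplex_def simplex_comp_hom simplex_comp_id simplex_comp_assoc)

lemma simplicial_set_boundary_simplex: "simplicial_set (boundary_simplex n)"
proof
  fix \<phi> l k \<sigma> assume *: "\<phi> \<in> simplex_hom l k" "\<sigma> \<in> simplices (boundary_simplex n) k"
  have "compose {..l} \<sigma> \<phi> ` {..l} \<subseteq> \<sigma> ` {..k}"
    using *(1) by (auto simp: compose_def simplex_hom_def)
  moreover have "\<sigma> ` {..k} \<subset> {..n}"
    using *(2) by (auto simp: boundary_simplex_def simplex_hom_def)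
  ultimately have "compose {..l} \<sigma> \<phi> ` {..l} \<noteq> {..n}"
    by blast
  then show "act (boundary_simplex n) l k \<phi> \<sigma> \<in> simplices (boundary_simplex n) l"
    using * by (simp add: boundary_simplex_def simplex_comp_hom)
qed (auto simp: boundary_simplex_def simplex_comp_id simplex_comp_assoc)

lemma partial_unital_magma_D_mag: "partial_unital_magma (D_mag n)"
proof
  fix x y z
  assume "x \<in> elems (D_mag n)" "y \<in> elems (D_mag n)" "pmult (D_mag n) x y = Some z"
  then show "z \<in> elems (D_mag n)"
    by (cases x; cases y) (auto simp: D_mag_def split: if_splits)
qed (auto simp: D_mag_def)

lemma D_map_hom:
  assumes "\<phi> \<in> simplex_hom m n"
  shows "restrict (D_map \<phi>) (elems (D_mag m)) \<in> mag_hom (D_mag m) (D_mag n)"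
proof -
  have le: "i \<le> j \<Longrightarrow> j \<le> m \<Longrightarrow> \<phi> i \<le> \<phi> j" and bd: "i \<le> m \<Longrightarrow> \<phi> i \<le> n" for i j
    using assms by (auto simp: simplex_hom_def mono_on_def)
  have 1: "D_map \<phi> x \<in> elems (D_mag n)" if "x \<in> elems (D_mag m)" for x
  proof (cases x)
    case DOne then show ?thesis by (simp add: D_mag_def)
  next
    case (DGen i j)
    then have "\<phi> i \<le> \<phi> j" "\<phi> j \<le> n"
      using that le[of i j] bd[of j] by (auto simp: D_mag_def)
    then show ?thesis using DGen by (auto simp: D_mag_def)
  qed
  have 2: "pmult (D_mag n) (D_map \<phi> x) (D_map \<phi> y) = Some (D_map \<phi> z)"
    if xy: "x \<in> elems (D_mag m)" "y \<in> elems (D_mag m)" and z: "pmult (D_mag m) x y = Some z" for x y z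
  proof (cases x)
    case DOne then show ?thesis using z by (auto simp: D_mag_def)
  next
    case x: (DGen i j)
    show ?thesis
    proof (cases y)
      case DOne then show ?thesis using z x by (auto simp: D_mag_def)
    next
      case y: (DGen k l)
      then have "\<phi> i \<le> \<phi> j" "\<phi> j \<le> \<phi> l" "k = j" "z = DGen i l"
        using xy z x le by (auto simp: D_mag_def split: if_splits)
      then show ?thesis using x y by (auto simp: D_mag_def)
    qed
  qed
  have 3: "z \<in> elems (D_mag m)"
    if "x \<in> elems (D_mag m)" "y \<in> elems (D_mag m)" "pmult (D_mag m) x y = Some z" for x y z
    using partial_unital_magma.pmult_closed[OF partial_unital_magma_D_mag] that by blast
  have 4: "pone (D_mag k) = DOne" "DOne \<in> elems (D_mag k)" for k
    by (simp_all add: D_mag_def)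
  show ?thesis
    unfolding mag_hom_def
  proof (intro CollectI conjI ballI allI impI)
    fix x y z
    assume *: "x \<in> elems (D_mag m)" "y \<in> elems (D_mag m)" "pmult (D_mag m) x y = Some z"
    show "pmult (D_mag n) (restrict (D_map \<phi>) (elems (D_mag m)) x)
        (restrict (D_map \<phi>) (elems (D_mag m)) y) = Some (restrict (D_map \<phi>) (elems (D_mag m)) z)"
      using 2[OF *] 3[OF *] * by simp
  qed (use 1 4 in auto)
qed

lemma mag_hom_comp:
  assumes "partial_unital_magma L" "f \<in> mag_hom L M" "g \<in> mag_hom M N"
  shows "compose (elems L) g f \<in> mag_hom L N"
proof -
  interpret partial_unital_magma L by fact
  have f: "f x \<in> elems M" if "x \<in> elems L" for x
    using assms(2) that by (auto simp: mag_hom_def)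
  have g: "g y \<in> elems N" if "y \<in> elems M" for y
    using assms(3) that by (auto simp: mag_hom_def)
  have gf: "pmult N (g (f x)) (g (f y)) = Some (g (f z))"
    if "x \<in> elems L" "y \<in> elems L" "pmult L x y = Some z" for x y z
    using that f assms(2,3) by (simp add: mag_hom_def)
  have one: "f (pone L) = pone M" "g (pone M) = pone N"
    using assms(2,3) by (simp_all add: mag_hom_def)
  show ?thesis
    unfolding mag_hom_def compose_def
  proof (intro CollectI conjI ballI allI impI)
    fix x y z
    assume *: "x \<in> elems L" "y \<in> elems L" "pmult L x y = Some z"
    show "pmult N ((\<lambda>x\<in>elems L. g (f x)) x) ((\<lambda>x\<in>elems L. g (f x)) y)
        = Some ((\<lambda>x\<in>elems L. g (f x)) z)"
      using gf[OF *] pmult_closed[OF *] * by simp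
  qed (simp_all add: f g one pone_closed)
qed

lemma simplicial_set_nerve: "simplicial_set (nerve M)"
proof
  fix \<phi> m n f assume *: "\<phi> \<in> simplex_hom m n" "f \<in> simplices (nerve M) n"
  have "compose (elems (D_mag m)) f (restrict (D_map \<phi>) (elems (D_mag m))) \<in> mag_hom (D_mag m) M"
    using * by (intro mag_hom_comp[OF partial_unital_magma_D_mag D_map_hom]) (auto simp: nerve_def)
  also have "compose (elems (D_mag m)) f (restrict (D_map \<phi>) (elems (D_mag m)))
      = compose (elems (D_mag m)) f (D_map \<phi>)"
    by (auto simp: compose_def)
  finally show "act (nerve M) m n \<phi> f \<in> simplices (nerve M) m"
    by (simp add: nerve_def)
next
  fix n f assume "f \<in> simplices (nerve M) n"
  then have "f \<in> extensional (elems (D_mag n))"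
    by (simp add: nerve_def mag_hom_def PiE_iff)
  moreover have "D_map (simplex_id n) x = x" if "x \<in> elems (D_mag n)" for x
    using that by (auto simp: D_mag_def simplex_id_def)
  ultimately show "act (nerve M) n n (simplex_id n) f = f"
    by (simp add: nerve_def compose_def extensional_restrict cong: restrict_cong)
next
  fix \<phi> \<psi> f k m n
  assume *: "\<phi> \<in> simplex_hom k m" "\<psi> \<in> simplex_hom m n"
  have "D_map (compose {..k} \<psi> \<phi>) x = D_map \<psi> (D_map \<phi> x)" if "x \<in> elems (D_mag k)" for x
    using that by (auto simp: D_mag_def compose_def)
  moreover have "D_map \<phi> x \<in> elems (D_mag m)" if "x \<in> elems (D_mag k)" for x
    using D_map_hom[OF *(1)] that by (auto simp: mag_hom_def)
  ultimately show "act (nerve M) k n (compose {..k} \<psi> \<phi>) f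
      = act (nerve M) k m \<phi> (act (nerve M) m n \<psi> f)"
    by (auto simp: nerve_def compose_def)
qed

lemma simplicial_map_nerve_map:
  assumes "h \<in> mag_hom M N"
  shows "simplicial_map (nerve M) (nerve N) (nerve_map M h)"
  unfolding simplicial_map_def
proof (intro conjI allI ballI)
  fix n show "nerve_map M h n \<in> simplices (nerve M) n \<rightarrow>\<^sub>E simplices (nerve N) n"
    using mag_hom_comp[OF partial_unital_magma_D_mag _ assms]
    by (auto simp: nerve_map_def nerve_def)
next
  fix m n \<phi> f assume *: "\<phi> \<in> simplex_hom m n" "f \<in> simplices (nerve M) n"
  then have "act (nerve M) m n \<phi> f \<in> simplices (nerve M) m"
    using simplicial_set.act_closed[OF simplicial_set_nerve] by blast
  moreover have "D_map \<phi> x \<in> elems (D_mag n)" if "x \<in> elems (D_mag m)" for x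
    using D_map_hom[OF *(1)] that by (auto simp: mag_hom_def)
  ultimately show "nerve_map M h m (act (nerve M) m n \<phi> f) = act (nerve N) m n \<phi> (nerve_map M h n f)"
    using *(2) by (auto simp: nerve_map_def nerve_def compose_def)
qed

end

theory Submission
  imports Defs
begin

text \<open>A simplex of the nerve of \<open>M\<close> is a family \<open>f\<^sub>i\<^sub>j\<close> of elements of \<open>M\<close> that satisfies one
  equation for each triangle \<open>i < j < k\<close>.  Hence it is determined by its spine, and it is
  assembled from its restrictions to edges and triangles, all of which lie in the boundary when
  \<open>n > 2\<close>.  Conversely, if \<open>X\<close> is spiny and reduced, then \<open>X\<^sub>1\<close> carries the partial
  multiplication \<open>d\<^sub>2 s \<cdot> d\<^sub>0 s = d\<^sub>1 s\<close> for \<open>s \<in> X\<^sub>2\<close>, and restriction to edges maps \<open>X\<close>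
  injectively to the nerve.  Surjectivity follows by induction on the dimension: the faces of a
  simplex of the nerve lift by the induction hypothesis, the lifts are compatible by injectivity,
  and coskeletality fills the resulting boundary.\<close>

section \<open>Edges, triangles and faces of a simplex\<close>

text \<open>The case \<open>i = j\<close> is the degenerate edge at \<open>i\<close>; it arises
  because a monotone map may collapse an edge.\<close>

definition edge :: "nat \<Rightarrow> nat \<Rightarrow> nat \<Rightarrow> nat" where
  "edge i j = (\<lambda>k\<in>{..1}. if k = 0 then i else j)"

definition triangle :: "nat \<Rightarrow> nat \<Rightarrow> nat \<Rightarrow> nat \<Rightarrow> nat" where
  "triangle i j k = (\<lambda>l\<in>{..2}. if l = 0 then i else if l = 1 then j else k)"

text \<open>For \<open>i \<le> Suc n\<close> this is the i-th coface map from [n] to [n+1], the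
  monotone injection that misses \<open>i\<close>.\<close>

definition coface :: "nat \<Rightarrow> nat \<Rightarrow> nat \<Rightarrow> nat" where
  "coface n i = (\<lambda>k\<in>{..n}. if k < i then k else Suc k)"

lemma edge_simps [simp]: "edge i j 0 = i" "edge i j (Suc 0) = j"
  by (simp_all add: edge_def)

lemma edge_hom: "i \<le> j \<Longrightarrow> j \<le> n \<Longrightarrow> edge i j \<in> simplex_hom 1 n"
  by (auto simp: edge_def simplex_hom_def mono_on_def)

lemma triangle_hom: "i \<le> j \<Longrightarrow> j \<le> k \<Longrightarrow> k \<le> n \<Longrightarrow> triangle i j k \<in> simplex_hom 2 n"
  by (auto simp: triangle_def simplex_hom_def mono_on_def)

lemma coface_hom: "coface n i \<in> simplex_hom n (Suc n)"
  by (auto simp: coface_def simplex_hom_def mono_on_def)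

lemma vertex_hom: "i \<le> n \<Longrightarrow> (\<lambda>_\<in>{..0}. i) \<in> simplex_hom 0 n"
  by (auto simp: simplex_hom_def mono_on_def)

lemma compose_edge: "compose {..Suc 0} \<phi> (edge i j) = edge (\<phi> i) (\<phi> j)"
  by (auto simp: compose_def edge_def)

lemma triangle_simps [simp]:
  "triangle i j k 0 = i" "triangle i j k (Suc 0) = j" "triangle i j k 2 = k"
  by (simp_all add: triangle_def)

lemma spine_edge_eq: "spine_edge i = edge i (Suc i)"
  by (auto simp: spine_edge_def edge_def)

lemma simplex_homD:
  assumes "\<phi> \<in> simplex_hom m n"
  shows "i \<le> j \<Longrightarrow> j \<le> m \<Longrightarrow> \<phi> i \<le> \<phi> j" "i \<le> m \<Longrightarrow> \<phi> i \<le> n"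
  using assms by (auto simp: simplex_hom_def mono_on_def)

lemma edge_image: "edge i j ` {..1} \<subseteq> {i, j}"
  by (auto simp: edge_def)

lemma triangle_image: "triangle i j k ` {..2} \<subseteq> {i, j, k}"
  by (auto simp: triangle_def)

text \<open>The n+1 vertices do not fit into a list of length at most n. So a simplex with few
  vertices cannot be surjective and lies in the boundary.\<close>

lemma small_image_neq:
  assumes "S \<subseteq> set xs" "length xs \<le> n"
  shows "S \<noteq> {..n}"
proof
  assume "S = {..n}"
  then have "Suc n \<le> card (set xs)"
    using card_mono[OF _ assms(1)] by simp
  with card_length[of xs] assms(2) show False by linarith
qed

lemma edge_in_boundary:
  assumes "i \<le> j" "j \<le> n" "2 \<le> n"
  shows "edge i j \<in> simplices (boundary_simplex n) 1"
  using small_image_neq[of "edge i j ` {..1}" "[i, j]" n] edge_image[of i j] edge_hom[OF assms(1,2)] assms(3)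
  by (simp add: boundary_simplex_def)

text \<open>At most three of the n+1 > 3 vertices are hit. This is where the dimension bound in
  coskeletality matters.\<close>

lemma triangle_in_boundary:
  assumes "i \<le> j" "j \<le> k" "k \<le> n" "2 < n"
  shows "triangle i j k \<in> simplices (boundary_simplex n) 2"
  using small_image_neq[of "triangle i j k ` {..2}" "[i, j, k]" n] triangle_image[of i j k]
    triangle_hom[OF assms(1-3)] assms(4)
  by (simp add: boundary_simplex_def)

text \<open>A non-surjective \<open>\<sigma>\<close> misses some vertex \<open>i\<close>, and
  deleting \<open>i\<close> from the codomain exhibits \<open>\<sigma>\<close> as a simplex of the
  face opposite \<open>i\<close>. Statements about faces thereby reach the whole boundary.\<close>

lemma boundary_factors_through_coface:
  assumes "\<sigma> \<in> simplices (boundary_simplex (Suc n)) k"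
  obtains \<tau> i where "\<tau> \<in> simplex_hom k n" "\<sigma> = compose {..k} (coface n i) \<tau>"
proof -
  have \<sigma>: "\<sigma> \<in> simplex_hom k (Suc n)" "\<sigma> ` {..k} \<noteq> {..Suc n}"
    using assms by (auto simp: boundary_simplex_def)
  have "\<sigma> ` {..k} \<subseteq> {..Suc n}"
    using \<sigma>(1) by (auto simp: simplex_hom_def)
  then obtain i where i: "i \<le> Suc n" "\<And>l. l \<le> k \<Longrightarrow> \<sigma> l \<noteq> i"
    using \<sigma>(2) by auto
  \<comment> \<open>In the second branch \<open>\<sigma> l > i\<close>, since \<open>i\<close> is
    missed, so the truncated subtraction is a true one.\<close>
  define \<tau> where "\<tau> = (\<lambda>l\<in>{..k}. if \<sigma> l < i then \<sigma> l else \<sigma> l - 1)"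
  have \<tau>: "\<tau> l \<le> n" if "l \<le> k" for l
    using i(2)[OF that] i(1) simplex_homD(2)[OF \<sigma>(1) that] that by (simp add: \<tau>_def) linarith
  have mono: "\<tau> a \<le> \<tau> b" if "a \<le> b" "b \<le> k" for a b
    using simplex_homD(1)[OF \<sigma>(1) that] i(2)[of a] i(2)[of b] that by (auto simp: \<tau>_def)
  have "\<tau> \<in> extensional {..k}"
    by (simp add: \<tau>_def)
  then have "\<tau> \<in> simplex_hom k n"
    using \<tau> mono by (auto simp: simplex_hom_def mono_on_def PiE_iff)
  moreover have "\<sigma> = compose {..k} (coface n i) \<tau>"
  proof (rule extensionalityI[of _ "{..k}"])
    fix l assume l: "l \<in> {..k}"
    then show "\<sigma> l = compose {..k} (coface n i) \<tau> l"
      using i(2)[of l] \<tau>[of l] by (auto simp: compose_def coface_def \<tau>_def)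
  qed (use \<sigma> in \<open>auto simp: simplex_hom_def PiE_iff\<close>)
  ultimately show thesis by (rule that)
qed


section \<open>Simplicial maps\<close>

lemma simplicial_mapD:
  assumes "simplicial_map X Y F"
  shows "x \<in> simplices X n \<Longrightarrow> F n x \<in> simplices Y n"
    and "F n \<in> extensional (simplices X n)"
    and "\<phi> \<in> simplex_hom m n \<Longrightarrow> x \<in> simplices X n \<Longrightarrow> F m (act X m n \<phi> x) = act Y m n \<phi> (F n x)"
  using assms by (auto simp: simplicial_map_def PiE_iff)

lemma simplicial_map_ext:
  assumes "simplicial_map X Y F" "simplicial_map X Y G"
    and "\<And>n x. x \<in> simplices X n \<Longrightarrow> F n x = G n x"
  shows "F = G"
proof
  fix n show "F n = G n"
    using assms by (intro extensionalityI[of _ "simplices X n"]) (auto dest: simplicial_mapD(2))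
qed

lemma simplicial_map_compose:
  assumes "simplicial_set X" "simplicial_map X Y F" "simplicial_map Y Z G"
  shows "simplicial_map X Z (\<lambda>n. compose (simplices X n) (G n) (F n))"
  using simplicial_set.act_closed[OF assms(1)] simplicial_mapD(1,3)[OF assms(2)]
    simplicial_mapD(1,3)[OF assms(3)]
  by (auto simp: simplicial_map_def compose_def)

text \<open>By the Yoneda lemma, maps out of \<open>\<Delta>\<^sup>n\<close> are given by \<open>\<sigma> \<mapsto> \<sigma>\<^sup>* x\<close>.\<close>

lemma simplicial_map_from_standard_simplex:
  assumes "simplicial_set X" "x \<in> simplices X n"
  shows "simplicial_map (standard_simplex n) X (\<lambda>k. \<lambda>\<sigma>\<in>simplex_hom k n. act X k n \<sigma> x)"
  using simplicial_set.act_closed[OF assms(1)] simplicial_set.act_comp[OF assms(1)] assms(2)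
  by (auto simp: simplicial_map_def standard_simplex_def simplex_comp_hom)

lemma simplicial_map_standard_simplex_eq:
  assumes "simplicial_map (standard_simplex n) X G" "\<sigma> \<in> simplex_hom k n"
  shows "G k \<sigma> = act X k n \<sigma> (G n (simplex_id n))"
proof -
  \<comment> \<open>Each \<open>\<sigma>\<close> is the restriction of the top simplex
    \<open>simplex_id n\<close> along itself, so naturality determines \<open>G\<close> from its
    value there.\<close>
  have "compose {..k} (simplex_id n) \<sigma> = \<sigma>"
    using assms(2)
    by (intro extensionalityI[of _ "{..k}"])
      (auto simp: simplex_hom_def simplex_id_def compose_def PiE_iff)
  then show ?thesis
    using simplicial_mapD(3)[OF assms(1,2), of "simplex_id n"]
    by (simp add: standard_simplex_def simplex_id_hom)
qed

text \<open>The levelwise inverse is automatically natural: apply it to the naturality square of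
  \<open>F\<close> at \<open>G n y\<close>.\<close>

lemma sset_isoI:
  assumes "simplicial_set X" "simplicial_map X Y F"
    and "\<And>n. bij_betw (F n) (simplices X n) (simplices Y n)"
  shows "sset_iso X Y"
proof -
  define G where "G = (\<lambda>n. \<lambda>y\<in>simplices Y n. inv_into (simplices X n) (F n) y)"
  have inj: "inj_on (F n) (simplices X n)" for n
    using assms(3) by (simp add: bij_betw_def)
  have GF: "G n (F n x) = x" if "x \<in> simplices X n" for n x
    using that inj[of n] simplicial_mapD(1)[OF assms(2) that] by (simp add: G_def)
  have FG: "F n (G n y) = y" "G n y \<in> simplices X n" if "y \<in> simplices Y n" for n y
    using that assms(3)[of n] by (auto simp: G_def bij_betw_def f_inv_into_f inv_into_into)
  have "G m (act Y m n \<phi> y) = act X m n \<phi> (G n y)"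
    if "\<phi> \<in> simplex_hom m n" "y \<in> simplices Y n" for m n \<phi> y
    using simplicial_mapD(3)[OF assms(2) that(1) FG(2)[OF that(2)]] FG[OF that(2)]
      GF[OF simplicial_set.act_closed[OF assms(1) that(1)]] by metis
  then have "simplicial_map Y X G"
    using FG(2) by (auto simp: simplicial_map_def) (simp add: G_def)
  with assms(2) GF FG(1) show ?thesis
    unfolding sset_iso_def by blast
qed

section \<open>Invariance of the three properties under isomorphism\<close>

lemma reduced_iso:
  assumes "sset_iso X Y" "reduced Y"
  shows "reduced X"
proof -
  obtain F G where F: "simplicial_map X Y F" and G: "simplicial_map Y X G"
    and GF: "\<And>n x. x \<in> simplices X n \<Longrightarrow> G n (F n x) = x"
    using assms(1) by (auto simp: sset_iso_def)
  obtain y where y: "simplices Y 0 = {y}"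
    using assms(2) by (auto simp: reduced_def is_singleton_def)
  have "x = G 0 y" if "x \<in> simplices X 0" for x
    using GF[OF that] simplicial_mapD(1)[OF F that] y by simp
  moreover have "G 0 y \<in> simplices X 0"
    using simplicial_mapD(1)[OF G, of y 0] y by simp
  ultimately have "simplices X 0 = {G 0 y}" by blast
  then show ?thesis by (simp add: reduced_def)
qed

lemma spiny_iso:
  assumes "sset_iso X Y" "spiny Y"
  shows "spiny X"
proof -
  obtain F G where F: "simplicial_map X Y F" and G: "simplicial_map Y X G"
    and GF: "\<And>n x. x \<in> simplices X n \<Longrightarrow> G n (F n x) = x"
    using assms(1) by (auto simp: sset_iso_def)
  have "x = x'" if n: "2 \<le> n" and x: "x \<in> simplices X n" "x' \<in> simplices X n"
    and eq: "spine_map X n x = spine_map X n x'" for n x x'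
  proof -
    \<comment> \<open>By naturality \<open>F\<close> carries spines to spines, so equal spines in
      \<open>X\<close> give equal spines in \<open>Y\<close>.\<close>
    have spine: "spine_map Y n (F n z) = (\<lambda>i\<in>{..<n}. F 1 (spine_map X n z i))"
      if "z \<in> simplices X n" for z
      using simplicial_mapD(3)[OF F spine_edge_hom that]
      by (auto simp: spine_map_def)
    have "F n x = F n x'"
      using spine[OF x(1)] spine[OF x(2)] eq assms(2) n simplicial_mapD(1)[OF F] x
      by (auto simp: spiny_def inj_on_def)
    then show ?thesis using GF x by metis
  qed
  then show ?thesis by (auto simp: spiny_def inj_on_def)
qed

text \<open>A boundary in \<open>X\<close> is pushed to \<open>Y\<close> along \<open>F\<close>,
  filled there, and the filler is brought back along \<open>G\<close>. Any filler \<open>K\<close>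
  in \<open>X\<close> is pushed to the unique filler \<open>H\<close> in \<open>Y\<close>, hence
  equals \<open>G\<close> after \<open>H\<close>.\<close>

lemma two_coskeletal_iso:
  assumes "sset_iso X Y" "two_coskeletal Y"
  shows "two_coskeletal X"
  unfolding two_coskeletal_def
proof (intro allI impI)
  fix n :: nat and B
  assume n: "2 < n" and B: "simplicial_map (boundary_simplex n) X B"
  obtain F G where F: "simplicial_map X Y F" and G: "simplicial_map Y X G"
    and GF: "\<And>n x. x \<in> simplices X n \<Longrightarrow> G n (F n x) = x"
    using assms(1) by (auto simp: sset_iso_def)
  let ?FB = "\<lambda>k. compose (simplices (boundary_simplex n) k) (F k) (B k)"
  have "simplicial_map (boundary_simplex n) Y ?FB"
    by (rule simplicial_map_compose[OF simplicial_set_boundary_simplex B F])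
  then have ex1: "\<exists>!H. simplicial_map (standard_simplex n) Y H \<and>
      (\<forall>k. \<forall>\<sigma>\<in>simplices (boundary_simplex n) k. H k \<sigma> = ?FB k \<sigma>)"
    using assms(2) n unfolding two_coskeletal_def by blast
  have FB: "?FB k \<sigma> = F k (B k \<sigma>)" if "\<sigma> \<in> simplices (boundary_simplex n) k" for k \<sigma>
    using that by (simp add: compose_def)
  obtain H where H: "simplicial_map (standard_simplex n) Y H"
    and HB: "\<And>k \<sigma>. \<sigma> \<in> simplices (boundary_simplex n) k \<Longrightarrow> H k \<sigma> = F k (B k \<sigma>)"
    and uniq: "\<And>H'. simplicial_map (standard_simplex n) Y H' \<Longrightarrow>
      (\<And>k \<sigma>. \<sigma> \<in> simplices (boundary_simplex n) k \<Longrightarrow> H' k \<sigma> = F k (B k \<sigma>)) \<Longrightarrow> H' = H"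
    using ex1 FB by (elim ex1E) (metis (no_types, lifting))
  have sub: "\<sigma> \<in> simplices (standard_simplex n) k" if "\<sigma> \<in> simplices (boundary_simplex n) k" for k \<sigma>
    using that by (simp add: boundary_simplex_def standard_simplex_def)
  let ?GH = "\<lambda>k. compose (simplices (standard_simplex n) k) (G k) (H k)"
  show "\<exists>!K. simplicial_map (standard_simplex n) X K \<and>
      (\<forall>k. \<forall>\<sigma>\<in>simplices (boundary_simplex n) k. K k \<sigma> = B k \<sigma>)"
  proof (intro ex1I[of _ ?GH] conjI allI ballI)
    show GH: "simplicial_map (standard_simplex n) X ?GH"
      by (rule simplicial_map_compose[OF simplicial_set_standard_simplex H G])
    show "?GH k \<sigma> = B k \<sigma>" if "\<sigma> \<in> simplices (boundary_simplex n) k" for k \<sigma>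
      using that sub[OF that] HB[OF that] GF simplicial_mapD(1)[OF B that]
      by (simp add: compose_def)
    fix K
    assume "simplicial_map (standard_simplex n) X K \<and>
      (\<forall>k. \<forall>\<sigma>\<in>simplices (boundary_simplex n) k. K k \<sigma> = B k \<sigma>)"
    then have K: "simplicial_map (standard_simplex n) X K"
      and KB: "\<And>k \<sigma>. \<sigma> \<in> simplices (boundary_simplex n) k \<Longrightarrow> K k \<sigma> = B k \<sigma>" by auto
    let ?FK = "\<lambda>k. compose (simplices (standard_simplex n) k) (F k) (K k)"
    have "?FK = H"
      using simplicial_map_compose[OF simplicial_set_standard_simplex K F] KB sub
      by (intro uniq) (auto simp: compose_def)
    then have "H k \<sigma> = F k (K k \<sigma>)" if "\<sigma> \<in> simplices (standard_simplex n) k" for k \<sigma>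
      using that by (auto simp: compose_def)
    then show "K = ?GH"
      using GF simplicial_mapD(1)[OF K]
      by (intro simplicial_map_ext[OF K GH]) (simp add: compose_def)
  qed
qed


section \<open>The nerve is spiny, reduced and 2-coskeletal\<close>

lemma elems_D_mag_iff: "x \<in> elems (D_mag n) \<longleftrightarrow> x = DOne \<or> (\<exists>i j. x = DGen i j \<and> i < j \<and> j \<le> n)"
  by (auto simp: D_mag_def)

lemma D_mag_sel [simp]: "pmult (D_mag n) = dgen_mult" "pone (D_mag n) = DOne"
  by (simp_all add: D_mag_def)

lemma nerve_simplexD:
  assumes "f \<in> simplices (nerve M) n"
  shows "f \<in> extensional (elems (D_mag n))" "f DOne = pone M"
    and "i < j \<Longrightarrow> j \<le> n \<Longrightarrow> f (DGen i j) \<in> elems M"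
    and "i < j \<Longrightarrow> j < k \<Longrightarrow> k \<le> n \<Longrightarrow> pmult M (f (DGen i j)) (f (DGen j k)) = Some (f (DGen i k))"
proof -
  have f: "f \<in> elems (D_mag n) \<rightarrow>\<^sub>E elems M" "f DOne = pone M"
    "\<And>x y z. x \<in> elems (D_mag n) \<Longrightarrow> y \<in> elems (D_mag n) \<Longrightarrow> dgen_mult x y = Some z \<Longrightarrow>
      pmult M (f x) (f y) = Some (f z)"
    using assms by (auto simp: nerve_def mag_hom_def)
  show "f \<in> extensional (elems (D_mag n))" "f DOne = pone M"
    using f by (auto simp: PiE_iff)
  show "i < j \<Longrightarrow> j \<le> n \<Longrightarrow> f (DGen i j) \<in> elems M"
    using f(1) by (auto simp: PiE_iff elems_D_mag_iff)
  show "i < j \<Longrightarrow> j < k \<Longrightarrow> k \<le> n \<Longrightarrow> pmult M (f (DGen i j)) (f (DGen j k)) = Some (f (DGen i k))"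
    by (rule f(3)) (auto simp: elems_D_mag_iff)
qed

text \<open>Products with a factor \<open>DOne\<close> are respected because of the unit laws of
  \<open>M\<close>, which leaves only the products of two generators.\<close>

lemma nerve_simplexI:
  assumes "partial_unital_magma M"
    and "f \<in> extensional (elems (D_mag n))" "f DOne = pone M"
    and gen: "\<And>i j. i < j \<Longrightarrow> j \<le> n \<Longrightarrow> f (DGen i j) \<in> elems M"
    and mult: "\<And>i j k. i < j \<Longrightarrow> j < k \<Longrightarrow> k \<le> n \<Longrightarrow>
      pmult M (f (DGen i j)) (f (DGen j k)) = Some (f (DGen i k))"
  shows "f \<in> simplices (nerve M) n"
proof -
  interpret partial_unital_magma M by fact
  have closed: "f x \<in> elems M" if "x \<in> elems (D_mag n)" for x
    using that gen assms(3) pone_closed by (auto simp: elems_D_mag_iff)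
  moreover have "pmult M (f x) (f y) = Some (f z)"
    if "x \<in> elems (D_mag n)" "y \<in> elems (D_mag n)" "dgen_mult x y = Some z" for x y z
  proof (cases "x = DOne \<or> y = DOne")
    case True
    then show ?thesis
      using that closed[OF that(1)] closed[OF that(2)] assms(3) pmult_pone pone_pmult
      by (cases x; cases y) auto
  next
    case False
    then show ?thesis
      using that mult by (auto simp: elems_D_mag_iff split: if_splits)
  qed
  ultimately show ?thesis
    using assms(2,3) by (auto simp: nerve_def mag_hom_def PiE_iff)
qed

lemma nerve_simplex_eqI:
  assumes "f \<in> simplices (nerve M) n" "g \<in> simplices (nerve M) n"
    and "\<And>i j. i < j \<Longrightarrow> j \<le> n \<Longrightarrow> f (DGen i j) = g (DGen i j)"
  shows "f = g"
  by (rule extensionalityI[of _ "elems (D_mag n)"])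
    (use assms(3) nerve_simplexD(1,2)[OF assms(1)] nerve_simplexD(1,2)[OF assms(2)] in
      \<open>auto simp: elems_D_mag_iff\<close>)

lemma nerve_act: "x \<in> elems (D_mag m) \<Longrightarrow> act (nerve M) m n \<phi> f x = f (D_map \<phi> x)"
  by (simp add: nerve_def compose_def)

text \<open>An edge of the nerve is recorded by its value at \<open>DGen 0 1\<close>, the only
  generator of \<open>D_mag 1\<close>.\<close>

lemma nerve_act_edge:
  "act (nerve M) 1 n (edge i j) f (DGen 0 1) = f (if i = j then DOne else DGen i j)"
  by (simp add: nerve_act elems_D_mag_iff)

text \<open>\<open>D_mag 0\<close> has no element besides the identity, whose image is
  prescribed.\<close>

lemma reduced_nerve:
  assumes "partial_unital_magma M"
  shows "reduced (nerve M)"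
proof -
  have "(\<lambda>_\<in>elems (D_mag 0). pone M) \<in> simplices (nerve M) 0"
    by (rule nerve_simplexI[OF assms]) (auto simp: elems_D_mag_iff)
  moreover have "f = g" if "f \<in> simplices (nerve M) 0" "g \<in> simplices (nerve M) 0" for f g
    using that by (rule nerve_simplex_eqI) simp
  ultimately have "simplices (nerve M) 0 = {\<lambda>_\<in>elems (D_mag 0). pone M}"
    by blast
  then show ?thesis by (simp add: reduced_def)
qed

lemma spiny_nerve: "spiny (nerve M)"
  unfolding spiny_def inj_on_def
proof (intro allI impI ballI)
  fix n :: nat and f g
  assume f: "f \<in> simplices (nerve M) n" and g: "g \<in> simplices (nerve M) n"
    and eq: "spine_map (nerve M) n f = spine_map (nerve M) n g"
  have spine: "f (DGen i (Suc i)) = g (DGen i (Suc i))" if "i < n" for i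
    using fun_cong[OF fun_cong[OF eq, of i], of "DGen 0 1"] that
    by (simp add: spine_map_def spine_edge_eq nerve_act_edge[unfolded One_nat_def])
  \<comment> \<open>The edge has length \<open>d + 1\<close>, so the base case is a spine edge. In
    the induction step the longer edge is the product of a shorter one with the next spine
    edge.\<close>
  have "f (DGen i (Suc (i + d))) = g (DGen i (Suc (i + d)))" if "Suc (i + d) \<le> n" for i d
    using that
  proof (induction d)
    case 0 then show ?case using spine[of i] by simp
  next
    case (Suc d)
    then show ?case
      using nerve_simplexD(4)[OF f, of i "Suc (i + d)" "Suc (Suc (i + d))"]
        nerve_simplexD(4)[OF g, of i "Suc (i + d)" "Suc (Suc (i + d))"] spine[of "Suc (i + d)"]
      by simp
  qed
  then show "f = g"
    by (intro nerve_simplex_eqI[OF f g]) (metis less_imp_Suc_add)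
qed

lemma two_coskeletal_nerve:
  assumes M: "partial_unital_magma M"
  shows "two_coskeletal (nerve M)"
  unfolding two_coskeletal_def
proof (intro allI impI)
  fix n :: nat and F
  assume n: "2 < n" and F: "simplicial_map (boundary_simplex n) (nerve M) F"
  have N: "simplicial_set (nerve M)" by (rule simplicial_set_nerve)
  have act: "act (boundary_simplex n) l k \<phi> \<sigma> = compose {..l} \<sigma> \<phi>" for l k \<phi> \<sigma>
    by (simp add: boundary_simplex_def)
  \<comment> \<open>Naturality along \<open>edge a b\<close> shows that the boundary map is
    determined by its values on edges.\<close>
  have F_edge: "F k \<sigma> (DGen a b) = F 1 (edge (\<sigma> a) (\<sigma> b)) (DGen 0 1)"
    if "\<sigma> \<in> simplices (boundary_simplex n) k" "a < b" "b \<le> k" for k \<sigma> a b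
  proof -
    have "F 1 (edge (\<sigma> a) (\<sigma> b)) = act (nerve M) 1 k (edge a b) (F k \<sigma>)"
      using simplicial_mapD(3)[OF F edge_hom[of a b k] that(1)] that by (simp add: act compose_edge)
    then show ?thesis
      using that by (simp add: nerve_act_edge del: One_nat_def)
  qed
  \<comment> \<open>A degenerate edge is pulled back from a vertex, so its generator is first sent
    to \<open>DOne\<close>.\<close>
  have F_degenerate: "F 1 (edge i i) (DGen 0 1) = pone M" if "i \<le> n" for i
  proof -
    let ?v = "\<lambda>_\<in>{..0::nat}. i"
    have v: "?v \<in> simplices (boundary_simplex n) 0"
      using vertex_hom[OF that] small_image_neq[of "?v ` {..0}" "[i]" n] n
      by (simp add: boundary_simplex_def)
    have "F 1 (edge i i) = act (nerve M) 1 0 (edge 0 0) (F 0 ?v)"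
      using simplicial_mapD(3)[OF F edge_hom[of 0 0 0] v] by (simp add: act compose_edge)
    then show ?thesis
      using nerve_simplexD(2)[OF simplicial_mapD(1)[OF F v]]
      by (simp add: nerve_act_edge del: One_nat_def)
  qed
  \<comment> \<open>The candidate for the top simplex of the filler is read off from the edges of
    the boundary.\<close>
  define f where "f = (\<lambda>x\<in>elems (D_mag n).
    case x of DOne \<Rightarrow> pone M | DGen i j \<Rightarrow> F 1 (edge i j) (DGen 0 1))"
  have f_one: "f DOne = pone M"
    by (simp add: f_def elems_D_mag_iff)
  have f_gen: "f (DGen i j) = F 1 (edge i j) (DGen 0 1)" if "i < j" "j \<le> n" for i j
    using that by (simp add: f_def elems_D_mag_iff)
  have f: "f \<in> simplices (nerve M) n"
  proof (rule nerve_simplexI[OF M])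
    show "f \<in> extensional (elems (D_mag n))" by (simp add: f_def)
    show "f DOne = pone M" by (rule f_one)
    show "f (DGen i j) \<in> elems M" if "i < j" "j \<le> n" for i j
      using nerve_simplexD(3)[OF simplicial_mapD(1)[OF F edge_in_boundary[of i j]], of 0 1] n that
      by (simp add: f_gen)
    fix i j k :: nat assume ijk: "i < j" "j < k" "k \<le> n"
    \<comment> \<open>The equation for \<open>i < j < k\<close> already holds in the image of this
      triangle under \<open>F\<close>.\<close>
    have t: "triangle i j k \<in> simplices (boundary_simplex n) 2"
      by (rule triangle_in_boundary) (use ijk n in auto)
    show "pmult M (f (DGen i j)) (f (DGen j k)) = Some (f (DGen i k))"
      using nerve_simplexD(4)[OF simplicial_mapD(1)[OF F t], of 0 1 2]
        F_edge[OF t, of 0 1] F_edge[OF t, of 1 2] F_edge[OF t, of 0 2] ijk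
      by (simp add: f_gen)
  qed
  \<comment> \<open>The form with \<open>i = j\<close> is needed because a simplex
    \<open>\<sigma>\<close> of the boundary may identify vertices.\<close>
  have f_edge: "f (if i = j then DOne else DGen i j) = F 1 (edge i j) (DGen 0 1)"
    if "i \<le> j" "j \<le> n" for i j
    using that F_degenerate f_one f_gen by simp
  let ?G = "\<lambda>k. \<lambda>\<sigma>\<in>simplex_hom k n. act (nerve M) k n \<sigma> f"
  have G: "simplicial_map (standard_simplex n) (nerve M) ?G"
    by (rule simplicial_map_from_standard_simplex[OF N f])
  show "\<exists>!G. simplicial_map (standard_simplex n) (nerve M) G \<and>
      (\<forall>k. \<forall>\<sigma>\<in>simplices (boundary_simplex n) k. G k \<sigma> = F k \<sigma>)"
  proof (intro ex1I[of _ ?G] conjI allI ballI)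
    fix k \<sigma> assume \<sigma>: "\<sigma> \<in> simplices (boundary_simplex n) k"
    then have hom: "\<sigma> \<in> simplex_hom k n" by (simp add: boundary_simplex_def)
    have "act (nerve M) k n \<sigma> f = F k \<sigma>"
    proof (rule nerve_simplex_eqI)
      show "act (nerve M) k n \<sigma> f \<in> simplices (nerve M) k"
        by (rule simplicial_set.act_closed[OF N hom f])
      show "F k \<sigma> \<in> simplices (nerve M) k" by (rule simplicial_mapD(1)[OF F \<sigma>])
      fix a b assume ab: "a < b" "b \<le> k"
      then show "act (nerve M) k n \<sigma> f (DGen a b) = F k \<sigma> (DGen a b)"
        using F_edge[OF \<sigma> ab] f_edge[of "\<sigma> a" "\<sigma> b"] simplex_homD(1)[OF hom, of a b]
          simplex_homD(2)[OF hom, of b]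
        by (simp add: nerve_act elems_D_mag_iff)
    qed
    with hom show "?G k \<sigma> = F k \<sigma>" by simp
  next
    fix H
    assume "simplicial_map (standard_simplex n) (nerve M) H \<and>
      (\<forall>k. \<forall>\<sigma>\<in>simplices (boundary_simplex n) k. H k \<sigma> = F k \<sigma>)"
    then have H: "simplicial_map (standard_simplex n) (nerve M) H"
      and HF: "\<And>k \<sigma>. \<sigma> \<in> simplices (boundary_simplex n) k \<Longrightarrow> H k \<sigma> = F k \<sigma>" by auto
    \<comment> \<open>Uniqueness: a filler is determined by its top simplex, and the edges of that
      simplex are prescribed by \<open>F\<close>.\<close>
    have "H n (simplex_id n) = f"
    proof (rule nerve_simplex_eqI[OF _ f])
      show "H n (simplex_id n) \<in> simplices (nerve M) n"
        using simplicial_mapD(1)[OF H] by (simp add: standard_simplex_def simplex_id_hom)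
      fix i j assume ij: "i < j" "j \<le> n"
      have "F 1 (edge i j) = act (nerve M) 1 n (edge i j) (H n (simplex_id n))"
        using HF[OF edge_in_boundary] simplicial_map_standard_simplex_eq[OF H edge_hom] ij n
        by (metis less_imp_le)
      then show "H n (simplex_id n) (DGen i j) = f (DGen i j)"
        using ij by (simp add: f_gen nerve_act_edge del: One_nat_def)
    qed
    then show "H = ?G"
      using simplicial_map_standard_simplex_eq[OF H]
      by (intro simplicial_map_ext[OF H G]) (simp add: standard_simplex_def)
  qed (rule G)
qed


section \<open>The partial unital magma of edges\<close>

text \<open>The element chosen by \<open>the_elem\<close> is meaningful for reduced \<open>X\<close>, and \<open>THE\<close> for spiny \<open>X\<close>.\<close>

definition edge_magma :: "'a sset \<Rightarrow> 'a pmag" where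
  "edge_magma X =
     \<lparr>elems = simplices X 1,
      pmult = (\<lambda>x y.
        if \<exists>s\<in>simplices X 2. act X 1 2 (edge 0 1) s = x \<and> act X 1 2 (edge 1 2) s = y
        then Some (act X 1 2 (edge 0 2)
          (THE s. s \<in> simplices X 2 \<and> act X 1 2 (edge 0 1) s = x \<and> act X 1 2 (edge 1 2) s = y))
        else None),
      pone = act X 1 0 (edge 0 0) (the_elem (simplices X 0))\<rparr>"

text \<open>The degree \<open>n\<close> component of the comparison map from \<open>X\<close> to
  \<open>nerve (edge_magma X)\<close>.\<close>

definition edges_of :: "'a sset \<Rightarrow> nat \<Rightarrow> 'a \<Rightarrow> dgen \<Rightarrow> 'a" where
  "edges_of X n = (\<lambda>x\<in>simplices X n. \<lambda>d\<in>elems (D_mag n).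
     case d of DOne \<Rightarrow> pone (edge_magma X) | DGen i j \<Rightarrow> act X 1 n (edge i j) x)"

section \<open>Products of edges in a spiny reduced simplicial set\<close>

locale spiny_reduced = simplicial_set +
  assumes spiny: "spiny X"
    and reduced: "reduced X"
begin

lemma act_edge:
  assumes "\<phi> \<in> simplex_hom m n" "x \<in> simplices X n" "i \<le> j" "j \<le> m"
  shows "act X 1 m (edge i j) (act X m n \<phi> x) = act X 1 n (edge (\<phi> i) (\<phi> j)) x"
  using act_comp[OF edge_hom[OF assms(3,4)] assms(1,2)] by (simp add: compose_edge)

lemma edge_closed: "x \<in> simplices X n \<Longrightarrow> i \<le> j \<Longrightarrow> j \<le> n \<Longrightarrow> act X 1 n (edge i j) x \<in> simplices X 1"
  by (rule act_closed[OF edge_hom])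

lemma edge_0_1: "x \<in> simplices X 1 \<Longrightarrow> act X 1 1 (edge 0 1) x = x"
proof -
  have "edge 0 1 = simplex_id 1"
    by (auto simp: edge_def simplex_id_def)
  then show "x \<in> simplices X 1 \<Longrightarrow> act X 1 1 (edge 0 1) x = x"
    using act_id by simp
qed

text \<open>The degenerate edge factors through the vertex \<open>i\<close> of \<open>x\<close>, and
  reducedness leaves only one vertex. All degenerate edges therefore coincide.\<close>

lemma act_degenerate_edge:
  assumes "x \<in> simplices X n" "i \<le> n"
  shows "act X 1 n (edge i i) x = pone (edge_magma X)"
proof -
  let ?v = "\<lambda>_\<in>{..0::nat}. i"
  have "act X 0 n ?v x \<in> simplices X 0"
    by (rule act_closed[OF vertex_hom[OF assms(2)] assms(1)])
  then have "act X 0 n ?v x = the_elem (simplices X 0)"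
    using reduced by (auto simp: reduced_def is_singleton_def)
  moreover have "act X 1 0 (edge 0 0) (act X 0 n ?v x) = act X 1 n (edge i i) x"
    using act_edge[OF vertex_hom[OF assms(2)] assms(1), of 0 0] by simp
  ultimately show ?thesis by (simp add: edge_magma_def)
qed

text \<open>Spininess covers dimensions from 2 on; in dimension 0 reducedness takes its place, and a
  1-simplex is its own spine.\<close>

lemma simplex_eqI:
  assumes x: "x \<in> simplices X n" "y \<in> simplices X n"
    and eq: "\<And>i. i < n \<Longrightarrow> act X 1 n (edge i (Suc i)) x = act X 1 n (edge i (Suc i)) y"
  shows "x = y"
proof -
  consider "n = 0" | "n = 1" | "2 \<le> n" by linarith
  then show ?thesis
  proof cases
    case 1
    then show ?thesis using x reduced by (auto simp: reduced_def is_singleton_def)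
  next
    case 2
    then show ?thesis using eq[of 0] edge_0_1 x by simp
  next
    case 3
    moreover have "spine_map X n x = spine_map X n y"
      using eq by (auto simp: spine_map_def spine_edge_eq)
    ultimately show ?thesis using spiny x by (auto simp: spiny_def inj_on_def)
  qed
qed

text \<open>Two composable edges bound at most one triangle, which makes the product in
  \<open>edge_magma\<close> well defined.\<close>

lemma triangle_eqI:
  assumes "s \<in> simplices X 2" "t \<in> simplices X 2"
    and "act X 1 2 (edge 0 1) s = act X 1 2 (edge 0 1) t"
    and "act X 1 2 (edge 1 2) s = act X 1 2 (edge 1 2) t"
  shows "s = t"
proof (rule simplex_eqI[OF assms(1,2)])
  fix i :: nat assume "i < 2"
  then have "i = 0 \<or> i = 1" by linarith
  then show "act X 1 2 (edge i (Suc i)) s = act X 1 2 (edge i (Suc i)) t"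
    using assms(3,4) by (auto simp: numeral_2_eq_2)
qed

lemma pmult_edge_magma_iff:
  "pmult (edge_magma X) x y = Some z \<longleftrightarrow>
    (\<exists>s\<in>simplices X 2. act X 1 2 (edge 0 1) s = x \<and> act X 1 2 (edge 1 2) s = y \<and>
      act X 1 2 (edge 0 2) s = z)"
proof -
  let ?P = "\<lambda>s. s \<in> simplices X 2 \<and> act X 1 2 (edge 0 1) s = x \<and> act X 1 2 (edge 1 2) s = y"
  have "(THE s. ?P s) = s" if "?P s" for s
    using that triangle_eqI by (intro the_equality) metis+
  then show ?thesis
    unfolding edge_magma_def by auto
qed

text \<open>The product is witnessed by the restriction of \<open>x\<close> to the triangle
  \<open>i\<close>, \<open>j\<close>, \<open>k\<close>. The inequalities are weak so that degenerate
  triangles yield the unit laws.\<close>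

lemma pmult_edges:
  assumes "x \<in> simplices X n" "i \<le> j" "j \<le> k" "k \<le> n"
  shows "pmult (edge_magma X) (act X 1 n (edge i j) x) (act X 1 n (edge j k) x) =
    Some (act X 1 n (edge i k) x)"
proof -
  have t: "triangle i j k \<in> simplex_hom 2 n"
    by (rule triangle_hom) (use assms in auto)
  show ?thesis
    unfolding pmult_edge_magma_iff
    by (rule bexI[OF _ act_closed[OF t assms(1)]])
      (use act_edge[OF t assms(1), of 0 1] act_edge[OF t assms(1), of 1 2]
        act_edge[OF t assms(1), of 0 2] in simp)
qed

lemma partial_unital_magma_edge_magma: "partial_unital_magma (edge_magma X)"
proof
  have elems: "elems (edge_magma X) = simplices X 1"
    by (simp add: edge_magma_def)
  obtain v where "v \<in> simplices X 0"
    using reduced by (auto simp: reduced_def is_singleton_def)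
  then show "pone (edge_magma X) \<in> elems (edge_magma X)"
    using edge_closed[of v 0 0 0] act_degenerate_edge[of v 0 0] by (simp add: elems)
  fix x assume "x \<in> elems (edge_magma X)"
  then have x: "x \<in> simplices X 1" by (simp add: elems)
  \<comment> \<open>The unit laws come from the two degenerate triangles on the edge
    \<open>x\<close>, with vertices 0, 1, 1 and 0, 0, 1.\<close>
  show "pmult (edge_magma X) x (pone (edge_magma X)) = Some x"
    using pmult_edges[OF x, of 0 1 1] act_degenerate_edge[OF x, of 1] edge_0_1[OF x] by simp
  show "pmult (edge_magma X) (pone (edge_magma X)) x = Some x"
    using pmult_edges[OF x, of 0 0 1] act_degenerate_edge[OF x, of 0] edge_0_1[OF x] by simp
next
  fix x y z assume "pmult (edge_magma X) x y = Some z"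
  then show "z \<in> elems (edge_magma X)"
    unfolding pmult_edge_magma_iff using edge_closed by (auto simp: edge_magma_def)
qed

section \<open>The comparison map: naturality and injectivity\<close>

lemma edges_of_gen:
  "x \<in> simplices X n \<Longrightarrow> i < j \<Longrightarrow> j \<le> n \<Longrightarrow> edges_of X n x (DGen i j) = act X 1 n (edge i j) x"
  by (simp add: edges_of_def elems_D_mag_iff)

text \<open>The argument is what \<open>D_map\<close> produces from a generator, including the case
  of collapsed indices, as naturality requires.\<close>

lemma edges_of_edge:
  "x \<in> simplices X n \<Longrightarrow> i \<le> j \<Longrightarrow> j \<le> n \<Longrightarrow>
    edges_of X n x (if i = j then DOne else DGen i j) = act X 1 n (edge i j) x"
  using act_degenerate_edge by (cases "i = j") (auto simp: edges_of_def elems_D_mag_iff)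

lemma edges_of_closed:
  assumes "x \<in> simplices X n"
  shows "edges_of X n x \<in> simplices (nerve (edge_magma X)) n"
proof (rule nerve_simplexI[OF partial_unital_magma_edge_magma])
  show "edges_of X n x \<in> extensional (elems (D_mag n))" "edges_of X n x DOne = pone (edge_magma X)"
    using assms by (simp_all add: edges_of_def elems_D_mag_iff)
  show "edges_of X n x (DGen i j) \<in> elems (edge_magma X)" if "i < j" "j \<le> n" for i j
    using that edges_of_gen[OF assms that] edge_closed[OF assms, of i j] by (simp add: edge_magma_def)
  show "pmult (edge_magma X) (edges_of X n x (DGen i j)) (edges_of X n x (DGen j k)) =
      Some (edges_of X n x (DGen i k))" if "i < j" "j < k" "k \<le> n" for i j k
    using pmult_edges[OF assms, of i j k] edges_of_gen[OF assms] that by simp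
qed

lemma simplicial_map_edges_of: "simplicial_map X (nerve (edge_magma X)) (edges_of X)"
  unfolding simplicial_map_def
proof (intro conjI allI ballI)
  show "edges_of X n \<in> simplices X n \<rightarrow>\<^sub>E simplices (nerve (edge_magma X)) n" for n
    using edges_of_closed by (auto simp: edges_of_def)
  fix m n \<phi> x assume \<phi>: "\<phi> \<in> simplex_hom m n" and x: "x \<in> simplices X n"
  show "edges_of X m (act X m n \<phi> x) = act (nerve (edge_magma X)) m n \<phi> (edges_of X n x)"
  proof (rule nerve_simplex_eqI)
    show "edges_of X m (act X m n \<phi> x) \<in> simplices (nerve (edge_magma X)) m"
      by (intro edges_of_closed act_closed[OF \<phi> x])
    show "act (nerve (edge_magma X)) m n \<phi> (edges_of X n x) \<in> simplices (nerve (edge_magma X)) m"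
      by (intro simplicial_set.act_closed[OF simplicial_set_nerve \<phi>] edges_of_closed x)
    fix i j assume ij: "i < j" "j \<le> m"
    then show "edges_of X m (act X m n \<phi> x) (DGen i j) =
        act (nerve (edge_magma X)) m n \<phi> (edges_of X n x) (DGen i j)"
      using edges_of_gen[OF act_closed[OF \<phi> x] ij] act_edge[OF \<phi> x, of i j]
        edges_of_edge[OF x, of "\<phi> i" "\<phi> j"] simplex_homD(1)[OF \<phi>, of i j] simplex_homD(2)[OF \<phi>, of j]
      by (simp add: nerve_act elems_D_mag_iff)
  qed
qed

text \<open>The spine edges are the values at the generators \<open>DGen i (Suc i)\<close>.\<close>

lemma inj_on_edges_of: "inj_on (edges_of X n) (simplices X n)"
proof
  fix x y assume x: "x \<in> simplices X n" "y \<in> simplices X n" and eq: "edges_of X n x = edges_of X n y"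
  show "x = y"
    using edges_of_gen[OF x(1)] edges_of_gen[OF x(2)] eq
    by (intro simplex_eqI[OF x]) (metis lessI Suc_leI)
qed

section \<open>Surjectivity of the comparison map\<close>

lemma edges_of_fill:
  assumes cosk: "two_coskeletal X" and n: "2 \<le> n"
    and surj: "simplices (nerve (edge_magma X)) n \<subseteq> edges_of X n ` simplices X n"
    and f: "f \<in> simplices (nerve (edge_magma X)) (Suc n)"
  shows "f \<in> edges_of X (Suc n) ` simplices X (Suc n)"
proof -
  let ?N = "nerve (edge_magma X)"
  note N = simplicial_set_nerve[of "edge_magma X"]
  \<comment> \<open>A boundary simplex lies in a face of dimension \<open>n\<close>. The face of
    \<open>f\<close> lifts by \<open>surj\<close>, and restricting its lift along
    \<open>\<tau>\<close> lifts the given simplex.\<close>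
  have lift: "\<exists>x\<in>simplices X k. edges_of X k x = act ?N k (Suc n) \<sigma> f"
    if \<sigma>: "\<sigma> \<in> simplices (boundary_simplex (Suc n)) k" for k \<sigma>
  proof -
    obtain \<tau> i where \<tau>: "\<tau> \<in> simplex_hom k n" "\<sigma> = compose {..k} (coface n i) \<tau>"
      using \<sigma> by (rule boundary_factors_through_coface)
    obtain y where y: "y \<in> simplices X n" "edges_of X n y = act ?N n (Suc n) (coface n i) f"
      using subsetD[OF surj simplicial_set.act_closed[OF N coface_hom f]] by (metis imageE)
    have "edges_of X k (act X k n \<tau> y) = act ?N k (Suc n) \<sigma> f"
      using simplicial_mapD(3)[OF simplicial_map_edges_of \<tau>(1) y(1)] y(2)
        simplicial_set.act_comp[OF N \<tau>(1) coface_hom f] \<tau>(2) by simp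
    then show ?thesis using act_closed[OF \<tau>(1) y(1)] by blast
  qed
  define F where "F k = (\<lambda>\<sigma>\<in>simplices (boundary_simplex (Suc n)) k.
    inv_into (simplices X k) (edges_of X k) (act ?N k (Suc n) \<sigma> f))" for k
  have F: "F k \<sigma> \<in> simplices X k" "edges_of X k (F k \<sigma>) = act ?N k (Suc n) \<sigma> f"
    if \<sigma>: "\<sigma> \<in> simplices (boundary_simplex (Suc n)) k" for k \<sigma>
  proof -
    have "act ?N k (Suc n) \<sigma> f \<in> edges_of X k ` simplices X k"
      using lift[OF \<sigma>] by (metis image_eqI)
    then show "F k \<sigma> \<in> simplices X k" "edges_of X k (F k \<sigma>) = act ?N k (Suc n) \<sigma> f"
      using \<sigma> by (simp_all add: F_def inv_into_into f_inv_into_f)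
  qed
  have "simplicial_map (boundary_simplex (Suc n)) X F"
    unfolding simplicial_map_def
  proof (intro conjI allI ballI)
    show "F k \<in> simplices (boundary_simplex (Suc n)) k \<rightarrow>\<^sub>E simplices X k" for k
      using F(1) by auto (simp add: F_def)
    fix l k \<phi> \<sigma> assume \<phi>: "\<phi> \<in> simplex_hom l k" and \<sigma>: "\<sigma> \<in> simplices (boundary_simplex (Suc n)) k"
    let ?\<sigma>' = "act (boundary_simplex (Suc n)) l k \<phi> \<sigma>"
    have \<sigma>': "?\<sigma>' \<in> simplices (boundary_simplex (Suc n)) l"
      by (rule simplicial_set.act_closed[OF simplicial_set_boundary_simplex \<phi> \<sigma>])
    have hom: "\<sigma> \<in> simplex_hom k (Suc n)"
      using \<sigma> by (simp add: boundary_simplex_def)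
    \<comment> \<open>Compatibility of the chosen lifts is checked after applying
      \<open>edges_of\<close>, which is injective and natural.\<close>
    have "edges_of X l (F l ?\<sigma>') = act ?N l (Suc n) (compose {..l} \<sigma> \<phi>) f"
      using F(2)[OF \<sigma>'] by (simp add: boundary_simplex_def)
    also have "\<dots> = act ?N l k \<phi> (edges_of X k (F k \<sigma>))"
      using simplicial_set.act_comp[OF N \<phi> hom f] F(2)[OF \<sigma>] by simp
    also have "\<dots> = edges_of X l (act X l k \<phi> (F k \<sigma>))"
      using simplicial_mapD(3)[OF simplicial_map_edges_of \<phi> F(1)[OF \<sigma>]] by simp
    finally show "F l ?\<sigma>' = act X l k \<phi> (F k \<sigma>)"
      by (rule inj_onD[OF inj_on_edges_of]) (intro F(1) \<sigma>' act_closed[OF \<phi>] \<sigma>)+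
  qed
  moreover have "2 < Suc n" using n by simp
  ultimately have "\<exists>!G. simplicial_map (standard_simplex (Suc n)) X G \<and>
      (\<forall>k. \<forall>\<sigma>\<in>simplices (boundary_simplex (Suc n)) k. G k \<sigma> = F k \<sigma>)"
    using cosk unfolding two_coskeletal_def by blast
  then obtain G where G: "simplicial_map (standard_simplex (Suc n)) X G"
    and GF: "\<And>k \<sigma>. \<sigma> \<in> simplices (boundary_simplex (Suc n)) k \<Longrightarrow> G k \<sigma> = F k \<sigma>"
    by (elim ex1E conjE) metis
  let ?x = "G (Suc n) (simplex_id (Suc n))"
  have x: "?x \<in> simplices X (Suc n)"
    using simplicial_mapD(1)[OF G] by (simp add: standard_simplex_def simplex_id_hom)
  \<comment> \<open>Equality is tested on edges. These lie in the boundary, where \<open>G\<close>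
    agrees with \<open>F\<close> and \<open>F\<close> lifts the restrictions of
    \<open>f\<close>.\<close>
  have "edges_of X (Suc n) ?x = f"
  proof (rule nerve_simplex_eqI[OF edges_of_closed[OF x] f])
    fix i j assume ij: "i < j" "j \<le> Suc n"
    have e: "edge i j \<in> simplices (boundary_simplex (Suc n)) 1"
      by (rule edge_in_boundary) (use ij n in auto)
    have "edges_of X (Suc n) ?x (DGen i j) = G 1 (edge i j)"
      using edges_of_gen[OF x ij] simplicial_map_standard_simplex_eq[OF G edge_hom[of i j]] ij by simp
    also have "\<dots> = edges_of X 1 (F 1 (edge i j)) (DGen 0 1)"
      using GF[OF e] edges_of_gen[OF F(1)[OF e], of 0 1] edge_0_1[OF F(1)[OF e]] by simp
    also have "\<dots> = f (DGen i j)"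
      using F(2)[OF e] ij by (simp add: nerve_act_edge del: One_nat_def)
    finally show "edges_of X (Suc n) ?x (DGen i j) = f (DGen i j)" .
  qed
  then show ?thesis using x by blast
qed

text \<open>Filling starts in dimension 3. Dimensions 0, 1 and 2 are settled by the single vertex,
  the elements of the magma and the definition of its product.\<close>

lemma edges_of_surj:
  assumes "two_coskeletal X"
  shows "simplices (nerve (edge_magma X)) n \<subseteq> edges_of X n ` simplices X n"
proof (induction n)
  case 0
  obtain v where v: "v \<in> simplices X 0"
    using reduced by (auto simp: reduced_def is_singleton_def)
  have "edges_of X 0 v = f" if "f \<in> simplices (nerve (edge_magma X)) 0" for f
    by (rule nerve_simplex_eqI[OF edges_of_closed[OF v] that]) simp
  then show ?case using v by blast
next
  case (Suc n)
  show ?case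
  proof
    fix f assume f: "f \<in> simplices (nerve (edge_magma X)) (Suc n)"
    consider "n = 0" | "n = 1" | "2 \<le> n" by linarith
    then show "f \<in> edges_of X (Suc n) ` simplices X (Suc n)"
    proof cases
      case 1
      let ?x = "f (DGen 0 1)"
      have x: "?x \<in> simplices X 1"
        using nerve_simplexD(3)[OF f, of 0 1] 1 by (simp add: edge_magma_def)
      have f1: "f \<in> simplices (nerve (edge_magma X)) 1"
        using f 1 by simp
      have "edges_of X 1 ?x = f"
        by (rule nerve_simplex_eqI[OF edges_of_closed[OF x] f1])
          (use edges_of_gen[OF x, of 0 1] edge_0_1[OF x] in \<open>auto simp: le_Suc_eq\<close>)
      with x show ?thesis unfolding 1 One_nat_def by (metis image_eqI)
    next
      case 2
      then have f2: "f \<in> simplices (nerve (edge_magma X)) 2"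
        using f by (simp add: numeral_2_eq_2)
      obtain s where s: "s \<in> simplices X 2" "act X 1 2 (edge 0 1) s = f (DGen 0 1)"
        "act X 1 2 (edge 1 2) s = f (DGen 1 2)" "act X 1 2 (edge 0 2) s = f (DGen 0 2)"
        \<comment> \<open>That the two spine edges of \<open>f\<close> are multiplicable means
          precisely that a triangle of \<open>X\<close> realises the product.\<close>
        using nerve_simplexD(4)[OF f2, of 0 1 2] unfolding pmult_edge_magma_iff by auto
      have "edges_of X 2 s = f"
      proof (rule nerve_simplex_eqI[OF edges_of_closed[OF s(1)] f2])
        fix i j :: nat assume ij: "i < j" "j \<le> 2"
        then consider "i = 0" "j = 1" | "i = 1" "j = 2" | "i = 0" "j = 2" by linarith
        then show "edges_of X 2 s (DGen i j) = f (DGen i j)"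
          by cases (use s edges_of_gen[OF s(1) ij] in simp_all)
      qed
      then show ?thesis using 2 s(1) by (auto simp: numeral_2_eq_2)
    next
      case 3
      then show ?thesis using edges_of_fill[OF assms _ Suc.IH f] by simp
    qed
  qed
qed

lemma sset_iso_nerve_edge_magma:
  assumes "two_coskeletal X"
  shows "sset_iso X (nerve (edge_magma X))"
proof (rule sset_isoI[OF _ simplicial_map_edges_of])
  show "simplicial_set X" by unfold_locales
  show "bij_betw (edges_of X n) (simplices X n) (simplices (nerve (edge_magma X)) n)" for n
    using inj_on_edges_of edges_of_surj[OF assms] edges_of_closed by (auto simp: bij_betw_def)
qed

end

section \<open>The two directions of the characterisation\<close>

lemma sset_iso_nerve_imp:
  assumes "partial_unital_magma M" "sset_iso X (nerve M)"
  shows "spiny X \<and> reduced X \<and> two_coskeletal X"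
  using spiny_iso[OF assms(2) spiny_nerve] reduced_iso[OF assms(2) reduced_nerve[OF assms(1)]]
    two_coskeletal_iso[OF assms(2) two_coskeletal_nerve[OF assms(1)]] by blast

text \<open>A magma can only be quantified over a fixed type. The edge magma lives on the
  1-simplices of \<open>X\<close>, so \<open>'a\<close> suffices for existence, while the second
  conjunct treats nerves of magmas over an arbitrary type \<open>'b\<close>.\<close>

theorem proposition4p19:
  fixes X :: "'a sset"
  assumes "simplicial_set X"
  shows "((\<exists>M :: 'a pmag. partial_unital_magma M \<and> sset_iso X (nerve M)) \<longleftrightarrow>
            spiny X \<and> reduced X \<and> two_coskeletal X) \<and>
         ((\<exists>M :: 'b pmag. partial_unital_magma M \<and> sset_iso X (nerve M)) \<longrightarrow>
            spiny X \<and> reduced X \<and> two_coskeletal X)"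
proof -
  have "\<exists>M :: 'a pmag. partial_unital_magma M \<and> sset_iso X (nerve M)"
    if "spiny X" "reduced X" "two_coskeletal X"
  proof -
    interpret spiny_reduced X
      using assms that by (simp add: spiny_reduced_def spiny_reduced_axioms_def)
    show ?thesis
      using partial_unital_magma_edge_magma sset_iso_nerve_edge_magma[OF that(3)] by blast
  qed
  moreover have "spiny X \<and> reduced X \<and> two_coskeletal X"
    if "\<exists>M :: 'a pmag. partial_unital_magma M \<and> sset_iso X (nerve M)"
    using that sset_iso_nerve_imp by blast
  moreover have "spiny X \<and> reduced X \<and> two_coskeletal X"
    if "\<exists>M :: 'b pmag. partial_unital_magma M \<and> sset_iso X (nerve M)"
    using that sset_iso_nerve_imp by blast
  ultimately show ?thesis by blast
qed

end
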